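(* Let $r\in\mathbb{N}$, $-1<x,y<1$ and $0\le z\le 1$ with $z\notin(\mathbb{Z}-y)/r$. Then $$\frac{\omega_2}{2\pi ir\xi}\frac{\partial}{\partial z}\mathfrak{K}_r(\xi;x,y,z;\omega_1,\omega_2)=\mathfrak{K}_r(\xi;x,y,z;\omega_1,\omega_2),$$ and $$\frac{\omega_2}{2\pi ir}\frac{\partial}{\partial z}\mathcal{K}_{k,r}(x,y,z;\omega_1,\omega_2)=k\,\mathcal{K}_{k-1,r}(x,y,z;\omega_1,\omega_2)\qquad(k\ge2).$$ Furthermore, $\mathcal{K}_{k,r}(x,y,z;\omega_1,\omega_2)$ is a polynomial function of degree at most $k-1$ in $z$ on any interval where $[y+rz]$ is constant, and its degree is exactly $k-1$ if and only if $\mathfrak{K}_r(0;x,y,z;\omega_1,\omega_2)\ne0$.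
   Context: Let $\omega_1,\omega_2\in\mathbb{C}\setminus\{0\}$ with $\tau=\omega_2/\omega_1$, $\Im\tau>0$. Let $\theta(z;\tau)=-i\sum_{n\in\mathbb{Z}}\exp(\pi i(n+\tfrac12)^2\tau+2\pi i(n+\tfrac12)z+\pi in)$. For $-1<x,y<1$, $(x,y)\ne(0,0)$, let $\mathfrak{E}(\xi;x,y;\omega_1,\omega_2)=\frac{e^{2\pi ix\xi/\omega_1}}{\omega_1}\frac{\theta'(0;\tau)\theta(\xi/\omega_1+x\tau-y;\tau)}{\theta(\xi/\omega_1;\tau)\theta(x\tau-y;\tau)}$, and $\mathfrak{E}(\xi;0,0;\omega_1,\omega_2)=\frac{1}{\omega_1}\frac{\theta'(\xi/\omega_1;\tau)}{\theta(\xi/\omega_1;\tau)}+\frac{2\pi i\xi}{\omega_1\omega_2}$. Let $\mathfrak{F}(\xi;z;\omega_2)=\frac{2\pi i}{\omega_2}\frac{e^{2\pi i\xi z/\omega_2}}{e^{2\pi i\xi/\omega_2}-1}$, $\mathfrak{D}_r(\xi)=\mathfrak{E}(\xi;x,y;\omega_1,\omega_2)\mathfrak{F}(\xi;z;\omega_2)^r$; for $(x,y,z)\ne(0,0,1)$, $\mathfrak{K}_r(\xi;x,y,z;\omega_1,\omega_2)=\operatorname{Res}_{\eta=0}\bigl(\mathfrak{D}_r(\xi)\eta^{-1}-\mathfrak{D}_r(\eta)\mathfrak{F}(\xi-\eta;\{y+rz\};\omega_2)\bigr)$, and $\mathfrak{K}_r(\xi;0,0,1;\omega_1,\omega_2)=(-1)^{r+1}\mathfrak{K}_r(-\xi;0,0,0;\omega_1,\omega_2)$.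 This function is holomorphic at $\xi=0$ and $\mathcal{K}_{k,r}$ is defined by $\mathfrak{K}_r(\xi;x,y,z;\omega_1,\omega_2)=\sum_{k\ge1}\frac{\mathcal{K}_{k,r}(x,y,z;\omega_1,\omega_2)}{k!}\xi^{k-1}$. $[t]$, $\{t\}$ denote integer and fractional part. *)

theory Defs
  imports "HOL-Complex_Analysis.Complex_Analysis"
begin

definition theta :: "complex \<Rightarrow> complex \<Rightarrow> complex" where
  "theta z \<tau> = - \<i> * (\<Sum>\<^sub>\<infinity>n::int. exp (of_real pi * \<i> * (of_int n + 1/2)\<^sup>2 * \<tau>
      + 2 * of_real pi * \<i> * (of_int n + 1/2) * z + of_real pi * \<i> * of_int n))"

text \<open>The prime denotes differentiation with respect to the first argument.\<close>

definition theta' :: "complex \<Rightarrow> complex \<Rightarrow> complex" where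
  "theta' z \<tau> = deriv (\<lambda>u. theta u \<tau>) z"

definition frakE :: "complex \<Rightarrow> real \<Rightarrow> real \<Rightarrow> complex \<Rightarrow> complex \<Rightarrow> complex" where
  "frakE \<xi> x y \<omega>1 \<omega>2 = (let \<tau> = \<omega>2 / \<omega>1 in
     if (x, y) = (0, 0)
     then 1 / \<omega>1 * (theta' (\<xi> / \<omega>1) \<tau> / theta (\<xi> / \<omega>1) \<tau>) + 2 * of_real pi * \<i> * \<xi> / (\<omega>1 * \<omega>2)
     else exp (2 * of_real pi * \<i> * of_real x * \<xi> / \<omega>1) / \<omega>1 *
            (theta' 0 \<tau> * theta (\<xi> / \<omega>1 + of_real x * \<tau> - of_real y) \<tau>) /
            (theta (\<xi> / \<omega>1) \<tau> * theta (of_real x * \<tau> - of_real y) \<tau>))"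

definition frakF :: "complex \<Rightarrow> real \<Rightarrow> complex \<Rightarrow> complex" where
  "frakF \<xi> z \<omega>2 = 2 * of_real pi * \<i> / \<omega>2 *
     (exp (2 * of_real pi * \<i> * \<xi> * of_real z / \<omega>2) / (exp (2 * of_real pi * \<i> * \<xi> / \<omega>2) - 1))"

definition frakD :: "nat \<Rightarrow> complex \<Rightarrow> real \<Rightarrow> real \<Rightarrow> real \<Rightarrow> complex \<Rightarrow> complex \<Rightarrow> complex" where
  "frakD r \<xi> x y z \<omega>1 \<omega>2 = frakE \<xi> x y \<omega>1 \<omega>2 * frakF \<xi> z \<omega>2 ^ r"

text \<open>
  The residue formula has removable singularities in \<open>\<xi>\<close>, in particular at \<open>\<xi> = 0\<close>, where it cannot
  be evaluated literally since \<open>frakD\<close> has a pole there; \<open>remove_sings\<close> passes to the holomorphic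
  extension. At the remaining poles, namely \<open>m \<omega>1 + n \<omega>2\<close> with \<open>m \<noteq> 0\<close>, it returns 0.
\<close>

definition frakK_res ::
  "nat \<Rightarrow> complex \<Rightarrow> real \<Rightarrow> real \<Rightarrow> real \<Rightarrow> complex \<Rightarrow> complex \<Rightarrow> complex" where
  "frakK_res r \<xi> x y z \<omega>1 \<omega>2 = remove_sings (\<lambda>\<xi>. residue (\<lambda>\<eta>. frakD r \<xi> x y z \<omega>1 \<omega>2 * inverse \<eta>
       - frakD r \<eta> x y z \<omega>1 \<omega>2 * frakF (\<xi> - \<eta>) (frac (y + real r * z)) \<omega>2) 0) \<xi>"

definition frakK ::
  "nat \<Rightarrow> complex \<Rightarrow> real \<Rightarrow> real \<Rightarrow> real \<Rightarrow> complex \<Rightarrow> complex \<Rightarrow> complex" where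
  "frakK r \<xi> x y z \<omega>1 \<omega>2 = (if (x, y, z) = (0, 0, 1)
     then (-1) ^ (r + 1) * frakK_res r (- \<xi>) 0 0 0 \<omega>1 \<omega>2
     else frakK_res r \<xi> x y z \<omega>1 \<omega>2)"

text \<open>
  \<open>calK k r x y z \<omega>1 \<omega>2 / k!\<close> is the coefficient of \<open>\<xi> ^ (k - 1)\<close> in the Taylor expansion
  of \<open>frakK\<close> at \<open>\<xi> = 0\<close>. Only \<open>k \<ge> 1\<close> is meaningful.
\<close>

definition calK ::
  "nat \<Rightarrow> nat \<Rightarrow> real \<Rightarrow> real \<Rightarrow> real \<Rightarrow> complex \<Rightarrow> complex \<Rightarrow> complex" where
  "calK k r x y z \<omega>1 \<omega>2 =
     fact k * fps_nth (fps_expansion (\<lambda>\<xi>. frakK r \<xi> x y z \<omega>1 \<omega>2) 0) (k - 1)"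

end

theory Submission
  imports Defs
begin

text \<open>
  As long as \<open>\<lfloor>y + r z\<rfloor>\<close> does not change, \<open>{y + r z}\<close> grows with slope \<open>r\<close> in \<open>z\<close>. So both terms of
  the residue formula depend on \<open>z\<close> only through the common factor \<open>exp (2 \<pi> \<i> r \<xi> z / \<omega>2)\<close>: in the
  second term the factors \<open>exp (2 \<pi> \<i> r \<eta> z / \<omega>2)\<close> and \<open>exp (2 \<pi> \<i> r (\<xi> - \<eta>) z / \<omega>2)\<close> combine. Hence
  \<open>frakK\<close> at \<open>t\<close> is \<open>exp (2 \<pi> \<i> r \<xi> (t - z) / \<omega>2)\<close> times \<open>frakK\<close> at \<open>z\<close>, and all claims follow by
  comparing Taylor coefficients in \<open>\<xi>\<close>. The latter requires that \<open>frakK\<close> is holomorphic at \<open>0\<close>: since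
  \<open>frakF\<close> has a simple pole with residue \<open>1\<close> there, the residue of the second term cancels the
  principal part of \<open>frakD\<close>. Of the theta function only holomorphy is used.
\<close>

section \<open>Holomorphy of the theta function\<close>

text \<open>Majorant for the Weierstrass test below: on each of the two half-lines of integers it is
  a geometric series with ratio \<open>exp (-1)\<close>.\<close>

lemma summable_on_exp_neg_abs_int: "(\<lambda>n::int. exp (- \<bar>real_of_int n\<bar>)) summable_on UNIV"
proof -
  let ?g = "\<lambda>n::int. exp (- \<bar>real_of_int n\<bar>)"
  have "summable (\<lambda>n. exp (-1) ^ n :: real)"
    by (rule summable_geometric) simp
  hence s: "(\<lambda>n::nat. exp (- real n)) summable_on UNIV"
    by (intro summable_nonneg_imp_summable_on) (simp_all flip: exp_of_nat_mult)
  have "?g summable_on range int"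
    by (subst summable_on_reindex) (use s in \<open>simp_all add: o_def\<close>)
  moreover have "?g summable_on range (\<lambda>n. - int n)"
    by (subst summable_on_reindex) (use s in \<open>simp_all add: o_def inj_def\<close>)
  hence "?g summable_on (range (\<lambda>n. - int n) - range int)"
    by (rule summable_on_subset_banach) auto
  ultimately have "?g summable_on (range int \<union> (range (\<lambda>n. - int n) - range int))"
    by (rule summable_on_Un_disjoint) auto
  moreover have "range int \<union> (range (\<lambda>n. - int n) - range int) = UNIV"
  proof -
    have "n \<in> range int \<union> (range (\<lambda>n. - int n) - range int)" for n
      by (cases n rule: int_cases2) auto
    thus ?thesis by blast
  qed
  ultimately show ?thesis by simp
qed

text \<open>The quadratic decay of the exponent in \<open>n\<close>, coming from
  \<open>Im \<tau> > 0\<close>, beats the linear growth allowed by \<open>z\<close> in a bounded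
  disc. Hence the series converges uniformly on discs of every radius.\<close>

lemma theta_analytic:
  assumes "Im \<tau> > 0"
  shows "(\<lambda>z. theta z \<tau>) analytic_on A"
proof -
  define t where "t n z = exp (of_real pi * \<i> * (of_int n + 1/2)\<^sup>2 * \<tau>
      + 2 * of_real pi * \<i> * (of_int n + 1/2) * z + of_real pi * \<i> * of_int n)" for n :: int and z
  have "(\<lambda>z. \<Sum>\<^sub>\<infinity>n. t n z) holomorphic_on ball 0 R" for R
  proof -
    \<comment> \<open>\<open>2 * pi * R\<close> controls the part of the exponent linear in
      \<open>n\<close>; the extra 1 leaves a factor \<open>exp (- \<bar>u\<bar>)\<close> to spare.
      \<open>C\<close> is the maximum of \<open>b * s - pi * Im \<tau> * s\<^sup>2\<close> over real
      \<open>s\<close>, found by completing the square.\<close>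
    define b where "b = 2 * pi * R + 1"
    define C where "C = b\<^sup>2 / (4 * (pi * Im \<tau>))"
    have bound: "norm (t n z) \<le> exp (C + 1) * exp (- \<bar>real_of_int n\<bar>)" if "z \<in> cball 0 R" for n z
    proof -
      define u where "u = real_of_int n + 1/2"
      have u: "complex_of_int n + 1/2 = of_real u" by (simp add: u_def)
      have "0 \<le> (2 * (pi * Im \<tau>) * \<bar>u\<bar> - b)\<^sup>2 / (4 * (pi * Im \<tau>))"
        using assms by simp
      also have "\<dots> = pi * Im \<tau> * u\<^sup>2 - b * \<bar>u\<bar> + C"
        using assms by (simp add: C_def field_simps power2_eq_square abs_if)
      finally have 1: "b * \<bar>u\<bar> - pi * Im \<tau> * u\<^sup>2 \<le> C" by simp
      have "\<bar>Im z\<bar> \<le> R" using that abs_Im_le_cmod[of z] by simp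
      hence "\<bar>u\<bar> * \<bar>Im z\<bar> \<le> \<bar>u\<bar> * R" by (rule mult_left_mono) simp
      hence "- (u * Im z) \<le> \<bar>u\<bar> * R" using abs_ge_minus_self[of "u * Im z"] by (simp add: abs_mult)
      hence "2 * pi * (- (u * Im z)) \<le> 2 * pi * (\<bar>u\<bar> * R)" by (intro mult_left_mono) simp_all
      hence "2 * pi * (- (u * Im z)) \<le> (b - 1) * \<bar>u\<bar>" by (simp add: b_def mult_ac)
      with 1 have "- (pi * Im \<tau> * u\<^sup>2) - 2 * pi * (u * Im z) \<le> C - \<bar>u\<bar>"
        by (simp add: algebra_simps)
      \<comment> \<open>The shift by 1/2 between \<open>u\<close> and \<open>n\<close> is absorbed
        by the additional 1.\<close>
      also have "\<dots> \<le> C + 1 - \<bar>real_of_int n\<bar>" by (simp add: u_def)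
      finally have "- (pi * Im \<tau> * u\<^sup>2) - 2 * pi * (u * Im z) \<le> C + 1 - \<bar>real_of_int n\<bar>" .
      thus ?thesis
        unfolding t_def u by (simp add: flip: exp_add of_real_power) (simp add: mult_ac)
    qed
    have ul: "uniform_limit (cball 0 R) (\<lambda>X z. \<Sum>n\<in>X. t n z) (\<lambda>z. \<Sum>\<^sub>\<infinity>n. t n z)
        (finite_subsets_at_top UNIV)"
      by (rule Weierstrass_m_test_general[OF bound])
         (auto intro!: summable_on_cmult_right summable_on_exp_neg_abs_int)
    show ?thesis
      by (rule holomorphic_uniform_limit[OF _ ul])
         (auto intro!: always_eventually continuous_intros holomorphic_intros simp: t_def)
  qed
  hence "(\<lambda>z. \<Sum>\<^sub>\<infinity>n. t n z) analytic_on {z}" for z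
    unfolding analytic_at by (intro exI[of _ "ball 0 (norm z + 1)"]) simp
  hence "(\<lambda>z. \<Sum>\<^sub>\<infinity>n. t n z) analytic_on A"
    using analytic_on_analytic_at by blast
  thus ?thesis
    unfolding theta_def t_def by (intro analytic_intros)
qed

section \<open>Meromorphy of the building blocks\<close>

lemma frakE_meromorphic:
  assumes "Im (\<omega>2 / \<omega>1) > 0"
  shows "(\<lambda>\<xi>. frakE \<xi> x y \<omega>1 \<omega>2) meromorphic_on A"
proof -
  have th: "(\<lambda>\<xi>. theta (f \<xi>) (\<omega>2 / \<omega>1)) meromorphic_on A" if "f analytic_on A" for f
    using analytic_on_compose[OF that theta_analytic[OF assms]]
    by (auto intro: analytic_on_imp_meromorphic_on simp: o_def)
  have th': "(\<lambda>\<xi>. theta' (f \<xi>) (\<omega>2 / \<omega>1)) meromorphic_on A" if "f analytic_on A" for f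
    unfolding theta'_def
    by (intro analytic_on_imp_meromorphic_on analytic_on_deriv theta_analytic assms that)
  have lin: "(\<lambda>\<xi>. \<xi> / \<omega>1) analytic_on A"
    by (cases "\<omega>1 = 0") (auto intro!: analytic_intros)
  have ex: "(\<lambda>\<xi>. exp (c * \<xi> / \<omega>1)) meromorphic_on A" for c
    by (cases "\<omega>1 = 0") (auto intro!: analytic_on_imp_meromorphic_on analytic_intros)
  show ?thesis
    unfolding frakE_def Let_def
    by (cases "(x, y) = (0, 0)")
       (auto intro!: meromorphic_intros th th' ex lin analytic_intros)
qed

text \<open>The affine argument serves both uses: \<open>a = 1\<close>, \<open>b = 0\<close> inside
  \<open>frakD\<close>, and \<open>a = -1\<close> for the factor
  \<open>frakF (\<xi> - \<eta>)\<close> as a function of \<open>\<eta>\<close>.\<close>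

lemma frakF_meromorphic: "(\<lambda>\<xi>. frakF (a * \<xi> + b) z \<omega>2) meromorphic_on A"
proof -
  have ex: "(\<lambda>\<xi>. exp (c * (a * \<xi> + b) * d / \<omega>2)) meromorphic_on A" for c d
    by (cases "\<omega>2 = 0") (auto intro!: analytic_on_imp_meromorphic_on analytic_intros)
  show ?thesis
    unfolding frakF_def using ex[of _ 1] by (auto intro!: meromorphic_intros ex)
qed

lemma frakD_meromorphic:
  assumes "Im (\<omega>2 / \<omega>1) > 0"
  shows "(\<lambda>\<xi>. frakD r \<xi> x y z \<omega>1 \<omega>2) meromorphic_on A"
  unfolding frakD_def using frakF_meromorphic[of 1 0] frakE_meromorphic[OF assms]
  by (auto intro!: meromorphic_intros)

section \<open>Principal parts and the residue formula near 0\<close>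

text \<open>The difference quotient at 0, completed by the derivative, is holomorphic. Since
  \<open>g\<close> is this quotient itself, the factorization holds for every \<open>z\<close>, not
  only near 0.\<close>

lemma analytic_at_0_factor:
  assumes "h analytic_on {0}"
  obtains g :: "complex \<Rightarrow> complex" where "g analytic_on {0}" "g 0 = deriv h 0" "\<And>z. h z = h 0 + z * g z"
proof -
  define g where "g = (\<lambda>z. if z = 0 then deriv h 0 else (h z - h 0) / (z - 0))"
  from assms obtain S where "open S" "0 \<in> S" "h holomorphic_on S"
    by (auto simp: analytic_at)
  hence "g analytic_on {0}"
    unfolding g_def analytic_at by (intro exI[of _ S] conjI pole_lemma_open)
  thus thesis by (rule that) (auto simp: g_def)
qed

text \<open>Induction on the order of the pole: splitting off \<open>h 0\<close> yields the
  coefficient of the highest negative power, and the remaining quotient has one power of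
  \<open>z\<close> less in the denominator.\<close>

lemma principal_part_of_analytic_over_power:
  assumes "h analytic_on {0}"
  shows "\<exists>g d. g analytic_on {0} \<and> (\<forall>z. z \<noteq> 0 \<longrightarrow> h z / z ^ n = g z + (\<Sum>i<n. d i / z ^ Suc i :: complex))"
  using assms
proof (induction n arbitrary: h)
  case 0
  thus ?case by (intro exI[of _ h]) auto
next
  case (Suc n)
  obtain k where k: "k analytic_on {0}" "\<And>z. h z = h 0 + z * k z"
    using analytic_at_0_factor[OF Suc.prems] by metis
  from Suc.IH[OF k(1)] obtain g d where g: "g analytic_on {0}"
    "\<And>z. z \<noteq> 0 \<Longrightarrow> k z / z ^ n = g z + (\<Sum>i<n. d i / z ^ Suc i)" by blast
  have "h z / z ^ Suc n = g z + (\<Sum>i<Suc n. (d(n := h 0)) i / z ^ Suc i)" if "z \<noteq> 0" for z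
  proof -
    have "h z / z ^ Suc n = h 0 / z ^ Suc n + k z / z ^ n"
      by (subst k(2)) (use that in \<open>simp add: field_simps\<close>)
    thus ?thesis using g(2)[OF that] by simp
  qed
  with g(1) show ?case by blast
qed

lemma meromorphic_principal_part:
  assumes "f meromorphic_on {0}"
  obtains g d n where "g analytic_on {0}"
    "eventually (\<lambda>z. f z = g z + (\<Sum>i<n. d i / z ^ Suc i :: complex)) (at 0)"
proof -
  from assms obtain F where F: "f has_laurent_expansion F"
    by (auto simp: meromorphic_on_def)
  \<comment> \<open>Truncation by \<open>nat\<close> treats poles and zeros together: for negative
    subdegree \<open>N\<close> is the pole order and the power in \<open>h\<close> is 1; otherwise
    \<open>N = 0\<close> and \<open>h\<close> carries the zero.\<close>
  define N where "N = nat (- fls_subdegree F)"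
  define h where "h = (\<lambda>z. eval_fps (fls_base_factor_to_fps F) z * z ^ nat (fls_subdegree F))"
  have "0 < fps_conv_radius (fls_base_factor_to_fps F)"
    using F by (simp add: has_laurent_expansion_def fls_conv_radius_altdef)
  hence "h analytic_on {0}"
    unfolding h_def by (intro analytic_intros analytic_on_eval_fps) (auto simp: zero_ereal_def)
  then obtain g d where g: "g analytic_on {0}"
    "\<And>z. z \<noteq> 0 \<Longrightarrow> h z / z ^ N = g z + (\<Sum>i<N. d i / z ^ Suc i)"
    using principal_part_of_analytic_over_power by metis
  have "eventually (\<lambda>z. f z = eval_fls F z) (at 0)"
    using F by (simp add: has_laurent_expansion_def eq_commute)
  moreover have "eventually (\<lambda>z::complex. z \<noteq> 0) (at 0)"
    by (simp add: eventually_at_filter)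
  ultimately have "eventually (\<lambda>z. f z = g z + (\<Sum>i<N. d i / z ^ Suc i)) (at 0)"
  proof eventually_elim
    case (elim z)
    have "eval_fls F z = h z / z ^ N"
      by (auto simp: eval_fls_def h_def N_def power_int_def field_simps)
    thus ?case using elim g(2) by simp
  qed
  with g(1) show thesis by (rule that)
qed

lemma higher_deriv_one_over:
  assumes "z \<noteq> 0"
  shows "(deriv ^^ n) (\<lambda>w::complex. 1 / w) z = (-1) ^ n * fact n / z ^ Suc n"
  using assms
proof (induction n arbitrary: z)
  case (Suc n)
  \<comment> \<open>The induction hypothesis holds at all nonzero points, hence throughout a
    neighbourhood of \<open>z\<close>, so it may be used under \<open>deriv\<close>.\<close>
  have "(deriv ^^ Suc n) (\<lambda>w. 1 / w) z = deriv (\<lambda>w. (-1) ^ n * fact n / w ^ Suc n) z"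
    using Suc by (auto intro!: deriv_cong_ev eventually_mono[OF t1_space_nhds])
  also have "\<dots> = (-1) ^ Suc n * fact (Suc n) / z ^ Suc (Suc n)"
  proof (rule DERIV_imp_deriv)
    have "((\<lambda>w. w ^ Suc n) has_field_derivative of_nat (Suc n) * z ^ n) (at z)"
      by (rule derivative_eq_intros refl)+ simp
    hence "((\<lambda>w. (-1) ^ n * fact n / w ^ Suc n) has_field_derivative
        (0 * z ^ Suc n - (-1) ^ n * fact n * (of_nat (Suc n) * z ^ n)) / (z ^ Suc n * z ^ Suc n)) (at z)"
      using Suc.prems by (intro DERIV_divide DERIV_const) auto
    also have "(0 * z ^ Suc n - (-1) ^ n * fact n * (of_nat (Suc n) * z ^ n)) / (z ^ Suc n * z ^ Suc n)
        = (-1) ^ Suc n * fact (Suc n) / z ^ Suc (Suc n)"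
      using Suc.prems by (simp add: field_simps)
    finally show "((\<lambda>w. (-1) ^ n * fact n / w ^ Suc n) has_field_derivative
        (-1) ^ Suc n * fact (Suc n) / z ^ Suc (Suc n)) (at z)" .
  qed
  finally show ?case .
qed simp

lemma residue_sum:
  assumes "open s" "z \<in> s" "\<And>i. i \<in> I \<Longrightarrow> f i holomorphic_on s - {z}"
  shows "residue (\<lambda>w. \<Sum>i\<in>I. f i w) z = (\<Sum>i\<in>I. residue (f i) z)"
  using assms(3)
proof (induction I rule: infinite_finite_induct)
  case (insert i I)
  hence "residue (\<lambda>w. f i w + (\<Sum>i\<in>I. f i w)) z = residue (f i) z + residue (\<lambda>w. \<Sum>i\<in>I. f i w) z"
    by (intro residue_add[OF assms(1,2)]) (auto intro!: holomorphic_intros)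
  with insert show ?case by simp
qed (simp_all add: residue_const)

text \<open>For fixed small \<open>\<xi> \<noteq> 0\<close>, \<open>F (\<xi> - \<eta>)\<close> is
  holomorphic in \<open>\<eta>\<close> near 0, so each term \<open>d i / \<eta> ^ Suc i\<close> of
  \<open>D\<close> picks out its \<open>i\<close>-th Taylor coefficient. The share of
  \<open>1 / \<xi>\<close> in this coefficient is \<open>1 / \<xi> ^ Suc i\<close>; summed up, these
  shares are exactly the principal part of \<open>D \<xi>\<close> and cancel.\<close>

lemma residue_removable_singularity:
  fixes D F f :: "complex \<Rightarrow> complex"
  assumes D: "D meromorphic_on {0}" and f: "f analytic_on {0}"
    and F: "eventually (\<lambda>\<xi>. F \<xi> = 1 / \<xi> + f \<xi>) (at 0)"
  obtains k where "k analytic_on {0}"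
    "eventually (\<lambda>\<xi>. residue (\<lambda>\<eta>. D \<xi> * inverse \<eta> - D \<eta> * F (\<xi> - \<eta>)) 0 = k \<xi>) (at 0)"
proof -
  obtain g d n where g: "g analytic_on {0}"
    and Dev: "eventually (\<lambda>z. D z = g z + (\<Sum>i<n. d i / z ^ Suc i)) (at 0)"
    using meromorphic_principal_part[OF D] by blast
  obtain S where S: "open S" "0 \<in> S" "f holomorphic_on S" "g holomorphic_on S"
    using f g analytic_at_two by blast
  obtain T where T: "open T" "0 \<in> T"
    "\<And>z. z \<in> T \<Longrightarrow> z \<noteq> 0 \<Longrightarrow> D z = g z + (\<Sum>i<n. d i / z ^ Suc i) \<and> F z = 1 / z + f z"
    using eventually_conj[OF Dev F] by (auto simp: eventually_at_topological)
  obtain e where e: "e > 0" "ball 0 e \<subseteq> S \<inter> T"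
    using openE[of "S \<inter> T" 0] S(1,2) T(1,2) by blast
  have hol: "f holomorphic_on ball 0 e" "g holomorphic_on ball 0 e"
    using S e by (auto intro: holomorphic_on_subset)
  have eq: "D z = g z + (\<Sum>i<n. d i / z ^ Suc i)" "F z = 1 / z + f z" if "z \<in> ball 0 e - {0}" for z
    using T(3)[of z] that e by auto
  \<comment> \<open>What survives the cancellation: the regular part of \<open>D\<close> minus the
    shares of the regular part \<open>f\<close> of \<open>F\<close>.\<close>
  define k where "k \<xi> = g \<xi> - (\<Sum>i<n. d i * ((-1) ^ i * (deriv ^^ i) f \<xi> / fact i))" for \<xi>
  have "k holomorphic_on ball 0 e"
    unfolding k_def by (intro holomorphic_intros hol holomorphic_higher_deriv) auto
  moreover have "residue (\<lambda>\<eta>. D \<xi> * inverse \<eta> - D \<eta> * F (\<xi> - \<eta>)) 0 = k \<xi>"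
    if \<xi>: "\<xi> \<in> ball 0 e - {0}" for \<xi>
  proof -
    \<comment> \<open>For \<open>\<eta>\<close> within this radius, \<open>\<xi> - \<eta>\<close>
      avoids 0 and stays in the disc where the expansions of \<open>D\<close> and \<open>F\<close>
      hold.\<close>
    define \<delta> where "\<delta> = min (norm \<xi>) (e - norm \<xi>)"
    have \<delta>: "\<delta> > 0" using \<xi> by (auto simp: \<delta>_def)
    have sub: "\<xi> - \<eta> \<in> ball 0 e - {0}" if "\<eta> \<in> ball 0 \<delta>" for \<eta> :: complex
      using that norm_triangle_ineq4[of \<xi> \<eta>] by (auto simp: \<delta>_def)
    have sub': "\<eta> \<in> ball 0 e" if "\<eta> \<in> ball 0 \<delta>" for \<eta> :: complex
      using that \<xi> norm_triangle_ineq3[of \<xi> \<eta>] by (auto simp: \<delta>_def)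
    define H where "H w = 1 / w + f w" for w
    have H: "H holomorphic_on ball 0 e - {0}"
      unfolding H_def using hol by (auto intro!: holomorphic_intros)
    define G where "G \<eta> = H ((-1) * \<eta> + \<xi>)" for \<eta>
    have "(H \<circ> (\<lambda>\<eta>. (-1) * \<eta> + \<xi>)) holomorphic_on ball 0 \<delta>"
      using sub by (intro holomorphic_on_compose_gen[OF _ H]) (auto intro!: holomorphic_intros)
    hence G: "G holomorphic_on ball 0 \<delta>"
      by (simp add: G_def[abs_def] o_def)
    \<comment> \<open>The sign from the inner function \<open>\<xi> - \<eta>\<close> cancels the
      sign in the derivatives of \<open>1 / w\<close>, but remains in front of those of
      \<open>f\<close>.\<close>
    have derG: "(deriv ^^ i) G 0 / fact i = 1 / \<xi> ^ Suc i + (-1) ^ i * (deriv ^^ i) f \<xi> / fact i" for i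
    proof -
      have "(deriv ^^ i) G 0 = (-1) ^ i * (deriv ^^ i) H ((-1) * 0 + \<xi>)"
        unfolding G_def
        by (rule higher_deriv_compose_linear'[OF H, of "ball 0 \<delta>"]) (use \<delta> sub in auto)
      also have "(deriv ^^ i) H ((-1) * 0 + \<xi>) = (deriv ^^ i) (\<lambda>w. 1 / w) \<xi> + (deriv ^^ i) f \<xi>"
        unfolding H_def using \<xi> hol
        by (subst higher_deriv_add[of _ "ball 0 e - {0}"]) (auto intro!: holomorphic_intros)
      also have "(deriv ^^ i) (\<lambda>w. 1 / w) \<xi> = (-1) ^ i * fact i / \<xi> ^ Suc i"
        using \<xi> by (intro higher_deriv_one_over) auto
      finally show ?thesis
        using \<xi> by (simp add: field_simps flip: power_mult_distrib)
    qed
    have hol1: "(\<lambda>\<eta>. d i * (G \<eta> / \<eta> ^ Suc i)) holomorphic_on ball 0 \<delta> - {0}" for i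
      by (intro holomorphic_intros holomorphic_on_subset[OF G]) auto
    have hol2: "g holomorphic_on ball 0 \<delta>" using sub' by (auto intro: holomorphic_on_subset[OF hol(2)])
    define P where "P \<eta> = (\<Sum>i<n. d i * (G \<eta> / \<eta> ^ Suc i))" for \<eta>
    have P: "P holomorphic_on ball 0 \<delta> - {0}"
      unfolding P_def by (intro holomorphic_intros hol1)
    have gG: "(\<lambda>\<eta>. g \<eta> * G \<eta>) holomorphic_on ball 0 \<delta>"
      by (intro holomorphic_intros G hol2)
    have "eventually (\<lambda>\<eta>. \<eta> \<in> ball 0 \<delta> - {0}) (at 0)"
      using \<delta> by (intro eventually_at_in_open) auto
    hence "eventually (\<lambda>\<eta>. D \<xi> * inverse \<eta> - D \<eta> * F (\<xi> - \<eta>)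
              = D \<xi> * inverse \<eta> - (g \<eta> * G \<eta> + P \<eta>)) (at 0)"
    proof eventually_elim
      case (elim \<eta>)
      have "F (\<xi> - \<eta>) = G \<eta>"
        using eq(2)[OF sub[of \<eta>]] elim by (simp add: G_def H_def)
      moreover have "D \<eta> = g \<eta> + (\<Sum>i<n. d i / \<eta> ^ Suc i)"
        using elim sub'[of \<eta>] by (intro eq) auto
      ultimately show ?case
        by (simp add: P_def algebra_simps sum_distrib_left sum_distrib_right)
    qed
    hence "residue (\<lambda>\<eta>. D \<xi> * inverse \<eta> - D \<eta> * F (\<xi> - \<eta>)) 0
        = residue (\<lambda>\<eta>. D \<xi> * inverse \<eta> - (g \<eta> * G \<eta> + P \<eta>)) 0"
      by (rule residue_cong) simp
    also have "\<dots> = residue (\<lambda>\<eta>. D \<xi> * inverse \<eta>) 0 - residue (\<lambda>\<eta>. g \<eta> * G \<eta> + P \<eta>) 0"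
      using \<delta>
      by (intro residue_diff[of "ball 0 \<delta>"])
         (auto intro!: holomorphic_intros P holomorphic_on_subset[OF hol2] holomorphic_on_subset[OF G])
    \<comment> \<open>The residue is taken in \<open>\<eta>\<close>, so \<open>D \<xi>\<close> is a
      constant here.\<close>
    also have "residue (\<lambda>\<eta>. D \<xi> * inverse \<eta>) 0 = D \<xi>"
      using residue_simple[of UNIV 0 "\<lambda>_. D \<xi>"] by (simp add: field_simps)
    also have "residue (\<lambda>\<eta>. g \<eta> * G \<eta> + P \<eta>) 0 = residue (\<lambda>\<eta>. g \<eta> * G \<eta>) 0 + residue P 0"
      using \<delta> by (intro residue_add[of "ball 0 \<delta>"]) (auto intro: P holomorphic_on_subset[OF gG])
    also have "residue (\<lambda>\<eta>. g \<eta> * G \<eta>) 0 = 0"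
      by (rule residue_holo[OF _ _ gG]) (use \<delta> in auto)
    also have "residue P 0 = (\<Sum>i<n. residue (\<lambda>\<eta>. d i * (G \<eta> / \<eta> ^ Suc i)) 0)"
      unfolding P_def using \<delta> by (intro residue_sum[of "ball 0 \<delta>"] hol1) auto
    also have "\<dots> = (\<Sum>i<n. d i * ((deriv ^^ i) G 0 / fact i))"
    proof (rule sum.cong[OF refl])
      fix i
      have "residue (\<lambda>\<eta>. d i * (G \<eta> / \<eta> ^ Suc i)) 0 = d i * residue (\<lambda>\<eta>. G \<eta> / \<eta> ^ Suc i) 0"
        by (rule residue_lmul[of "ball 0 \<delta>"])
           (use \<delta> in \<open>auto intro!: holomorphic_intros holomorphic_on_subset[OF G]\<close>)
      also have "residue (\<lambda>\<eta>. G \<eta> / \<eta> ^ Suc i) 0 = (deriv ^^ i) G 0 / fact i"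
        by (rule residue_holomorphic_over_power'[OF _ _ G]) (use \<delta> in auto)
      finally show "residue (\<lambda>\<eta>. d i * (G \<eta> / \<eta> ^ Suc i)) 0 = d i * ((deriv ^^ i) G 0 / fact i)" .
    qed
    finally show ?thesis
      unfolding derG eq(1)[OF \<xi>] k_def by (simp add: ring_distribs sum.distrib)
  qed
  hence "eventually (\<lambda>\<xi>. residue (\<lambda>\<eta>. D \<xi> * inverse \<eta> - D \<eta> * F (\<xi> - \<eta>)) 0 = k \<xi>) (at 0)"
    using e(1) by (intro eventually_mono[OF eventually_at_in_open[of "ball 0 e" 0]]) auto
  ultimately show thesis
    using e(1) by (intro that[of k]) (auto simp: analytic_at intro!: exI[of _ "ball 0 e"])
qed

section \<open>Holomorphy of \<open>frakK\<close> at 0\<close>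

text \<open>Write \<open>exp (c * \<xi>) - 1 = \<xi> * g \<xi>\<close> with \<open>g 0 = c\<close>.
  Then \<open>frakF\<close> is \<open>u \<xi> / \<xi>\<close> with \<open>u 0 = 1\<close>, and
  splitting off the value of \<open>u\<close> at 0 gives the simple pole with residue 1.\<close>

lemma frakF_simple_pole:
  assumes "\<omega>2 \<noteq> 0"
  obtains f where "f analytic_on {0}" "eventually (\<lambda>\<xi>. frakF \<xi> z \<omega>2 = 1 / \<xi> + f \<xi>) (at 0)"
proof -
  define c where "c = 2 * of_real pi * \<i> / \<omega>2"
  have c: "c \<noteq> 0" using assms by (simp add: c_def)
  obtain g where g: "g analytic_on {0}" "g 0 = deriv (\<lambda>\<xi>. exp (c * \<xi>)) 0"
      "\<And>\<xi>. exp (c * \<xi>) = exp (c * 0) + \<xi> * g \<xi>"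
    using analytic_at_0_factor[of "\<lambda>\<xi>. exp (c * \<xi>)"] by (auto intro!: analytic_intros)
  have "deriv (\<lambda>\<xi>. exp (c * \<xi>)) 0 = c"
    by (rule DERIV_imp_deriv) (auto intro!: derivative_eq_intros)
  with g(2) c have g0: "g 0 = c" by simp
  define u where "u \<xi> = c * exp (c * z * \<xi>) / g \<xi>" for \<xi>
  have "u analytic_on {0}"
    unfolding u_def using g(1) g0 c by (intro analytic_intros) auto
  then obtain f where f: "f analytic_on {0}" "\<And>\<xi>. u \<xi> = u 0 + \<xi> * f \<xi>"
    using analytic_at_0_factor[of u] by metis
  have u0: "u 0 = 1" using g0 c by (simp add: u_def)
  have "frakF \<xi> z \<omega>2 = 1 / \<xi> + f \<xi>" if "\<xi> \<noteq> 0" for \<xi>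
  proof -
    have "frakF \<xi> z \<omega>2 = c * exp (c * z * \<xi>) / (exp (c * \<xi>) - 1)"
      by (simp add: frakF_def c_def mult_ac)
    \<comment> \<open>At zeros of \<open>g\<close>, that is, at the other poles, both sides are 0
      because division by zero yields 0.\<close>
    also have "\<dots> = u \<xi> / \<xi>"
      using g(3)[of \<xi>] that by (simp add: u_def)
    also have "\<dots> = 1 / \<xi> + f \<xi>"
      using f(2)[of \<xi>] u0 that by (simp add: field_simps)
    finally show ?thesis .
  qed
  hence "eventually (\<lambda>\<xi>. frakF \<xi> z \<omega>2 = 1 / \<xi> + f \<xi>) (at 0)"
    by (simp add: eventually_at_filter)
  with f(1) show thesis by (rule that)
qed

lemma remove_sings_analytic_of_eventually_eq:
  assumes "k analytic_on {z}" "eventually (\<lambda>w. f w = k w) (at z)"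
  shows "remove_sings f analytic_on {z}"
proof (rule remove_sings_analytic_at)
  have "k \<midarrow>z\<rightarrow> k z"
    using assms(1) by (simp add: analytic_at_imp_isCont isContD)
  thus "f \<midarrow>z\<rightarrow> k z"
    using assms(2) tendsto_cong by blast
  have "isolated_singularity_at k z"
    using assms(1) by (simp add: isolated_singularity_at_analytic)
  thus "isolated_singularity_at f z"
    using isolated_singularity_at_cong[OF assms(2) refl] by simp
qed

lemma frakK_res_analytic:
  assumes "\<omega>2 \<noteq> 0" "Im (\<omega>2 / \<omega>1) > 0"
  shows "(\<lambda>\<xi>. frakK_res r \<xi> x y z \<omega>1 \<omega>2) analytic_on {0}"
proof -
  obtain f where "f analytic_on {0}"
    "eventually (\<lambda>\<xi>. frakF \<xi> (frac (y + real r * z)) \<omega>2 = 1 / \<xi> + f \<xi>) (at 0)"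
    using frakF_simple_pole[OF assms(1)] .
  from residue_removable_singularity[OF frakD_meromorphic[OF assms(2)] this]
  obtain k where "k analytic_on {0}"
    "eventually (\<lambda>\<xi>. residue (\<lambda>\<eta>. frakD r \<xi> x y z \<omega>1 \<omega>2 * inverse \<eta>
       - frakD r \<eta> x y z \<omega>1 \<omega>2 * frakF (\<xi> - \<eta>) (frac (y + real r * z)) \<omega>2) 0 = k \<xi>) (at 0)" .
  thus ?thesis
    unfolding frakK_res_def[abs_def] by (rule remove_sings_analytic_of_eventually_eq)
qed

text \<open>This makes \<open>calK\<close> genuine Taylor coefficients of \<open>frakK\<close>. In
  the exceptional case the reflection of \<open>\<xi>\<close> fixes 0 and so preserves analyticity
  there.\<close>

lemma frakK_analytic:
  assumes "\<omega>2 \<noteq> 0" "Im (\<omega>2 / \<omega>1) > 0"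
  shows "(\<lambda>\<xi>. frakK r \<xi> x y z \<omega>1 \<omega>2) analytic_on {0}"
proof -
  have "((\<lambda>\<xi>. frakK_res r \<xi> 0 0 0 \<omega>1 \<omega>2) \<circ> uminus) analytic_on {0}"
    by (intro analytic_on_compose) (auto intro!: analytic_intros frakK_res_analytic assms)
  thus ?thesis
    unfolding frakK_def
    by (cases "(x, y, z) = (0, 0, 1)") (auto intro!: analytic_intros frakK_res_analytic assms simp: o_def)
qed

section \<open>Exponential dependence on \<open>z\<close>\<close>

lemma residue_meromorphic_cmult:
  assumes "f meromorphic_on {z}"
  shows "residue (\<lambda>w. c * f w) z = c * residue f z"
proof -
  have "isolated_singularity_at f z"
    using assms by (simp add: meromorphic_at_iff)
  then obtain A where "z \<in> A" "open A" "f analytic_on A - {z}"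
    by (auto simp: isolated_singularity_at_iff_analytic_nhd)
  thus ?thesis
    by (intro residue_lmul[of A]) (auto intro: analytic_imp_holomorphic)
qed

text \<open>As \<open>h\<close> has a nonzero limit, \<open>f\<close> converges at \<open>z\<close>
  iff the product does; if neither converges, both sides are the default value 0.\<close>

lemma remove_sings_mult:
  fixes f h :: "complex \<Rightarrow> complex"
  assumes "isCont h z" "h z \<noteq> 0"
  shows "remove_sings (\<lambda>w. h w * f w) z = h z * remove_sings f z"
proof -
  have h: "h \<midarrow>z\<rightarrow> h z" using assms(1) by (simp add: isContD)
  show ?thesis
  proof (cases "\<exists>c. f \<midarrow>z\<rightarrow> c")
    case True
    then obtain c where c: "f \<midarrow>z\<rightarrow> c" by blast
    show ?thesis
      using remove_sings_eqI[OF c] remove_sings_eqI[OF tendsto_mult[OF h c]] by simp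
  next
    case False
    have "\<not> (\<lambda>w. h w * f w) \<midarrow>z\<rightarrow> c" for c
    proof
      assume "(\<lambda>w. h w * f w) \<midarrow>z\<rightarrow> c"
      from tendsto_divide[OF this h assms(2)] have "(\<lambda>w. h w * f w / h w) \<midarrow>z\<rightarrow> c / h z" .
      moreover have "eventually (\<lambda>w. h w * f w / h w = f w) (at z)"
        using tendsto_imp_eventually_ne[OF h assms(2)] by eventually_elim simp
      ultimately have "f \<midarrow>z\<rightarrow> c / h z"
        by (rule Lim_transform_eventually)
      with False show False by blast
    qed
    with False show ?thesis by (simp add: remove_sings_def)
  qed
qed

lemma frakF_exp:
  "frakF \<xi> t \<omega>2 = exp (2 * of_real pi * \<i> / \<omega>2 * \<xi> * of_real (t - z)) * frakF \<xi> z \<omega>2"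
proof -
  have "exp (2 * of_real pi * \<i> * \<xi> * of_real t / \<omega>2) =
      exp (2 * of_real pi * \<i> / \<omega>2 * \<xi> * of_real (t - z)) * exp (2 * of_real pi * \<i> * \<xi> * of_real z / \<omega>2)"
    unfolding exp_add[symmetric] by (rule arg_cong[of _ _ exp], cases "\<omega>2 = 0") (simp_all add: field_simps)
  thus ?thesis by (simp add: frakF_def)
qed

lemma frakD_exp:
  "frakD r \<xi> x y t \<omega>1 \<omega>2 =
     exp (2 * of_real pi * \<i> * of_nat r / \<omega>2 * \<xi> * of_real (t - z)) * frakD r \<xi> x y z \<omega>1 \<omega>2"
proof -
  have "exp (2 * of_real pi * \<i> / \<omega>2 * \<xi> * of_real (t - z)) ^ r =
      exp (2 * of_real pi * \<i> * of_nat r / \<omega>2 * \<xi> * of_real (t - z))"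
    unfolding exp_of_nat_mult[symmetric] by (rule arg_cong[of _ _ exp]) (simp only: times_divide_eq_left times_divide_eq_right mult_ac)
  thus ?thesis
    unfolding frakD_def frakF_exp[of \<xi> t \<omega>2 z] power_mult_distrib by (simp only: mult_ac)
qed

text \<open>The relation holds at every \<open>\<xi>\<close>, poles included, since
  \<open>remove_sings\<close> commutes with multiplication by the nonvanishing continuous
  factor.\<close>

lemma frakK_res_exp:
  assumes "Im (\<omega>2 / \<omega>1) > 0" "\<lfloor>y + real r * t\<rfloor> = \<lfloor>y + real r * z\<rfloor>"
  shows "frakK_res r \<xi> x y t \<omega>1 \<omega>2 =
     exp (2 * of_real pi * \<i> * of_nat r / \<omega>2 * \<xi> * of_real (t - z)) * frakK_res r \<xi> x y z \<omega>1 \<omega>2"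
proof -
  define a where "a = 2 * of_real pi * \<i> * of_nat r / \<omega>2"
  define e where "e \<zeta> = exp (a * \<zeta> * of_real (t - z))" for \<zeta>
  define R where "R s \<zeta> = residue (\<lambda>\<eta>. frakD r \<zeta> x y s \<omega>1 \<omega>2 * inverse \<eta>
      - frakD r \<eta> x y s \<omega>1 \<omega>2 * frakF (\<zeta> - \<eta>) (frac (y + real r * s)) \<omega>2) 0" for s \<zeta>
  have D: "frakD r \<zeta> x y t \<omega>1 \<omega>2 = e \<zeta> * frakD r \<zeta> x y z \<omega>1 \<omega>2" for \<zeta>
    using frakD_exp[of r \<zeta> x y t \<omega>1 \<omega>2 z] by (simp add: e_def a_def)
  have fr: "frac (y + real r * t) - frac (y + real r * z) = real r * (t - z)"
    using assms(2) by (simp add: frac_def algebra_simps)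
  have F: "frakF \<zeta> (frac (y + real r * t)) \<omega>2 = e \<zeta> * frakF \<zeta> (frac (y + real r * z)) \<omega>2" for \<zeta>
    using frakF_exp[of \<zeta> "frac (y + real r * t)" \<omega>2 "frac (y + real r * z)"]
    unfolding fr by (simp add: e_def a_def mult_ac)
  have "R t \<zeta> = e \<zeta> * R z \<zeta>" for \<zeta>
  proof -
    \<comment> \<open>Additivity of the exponent removes \<open>\<eta>\<close> from the factor,
      which can then be pulled out of the residue.\<close>
    have e: "e \<eta> * e (\<zeta> - \<eta>) = e \<zeta>" for \<eta>
      unfolding e_def exp_add[symmetric] by (rule arg_cong[of _ _ exp]) (simp add: algebra_simps)
    have "frakD r \<zeta> x y t \<omega>1 \<omega>2 * inverse \<eta>
      - frakD r \<eta> x y t \<omega>1 \<omega>2 * frakF (\<zeta> - \<eta>) (frac (y + real r * t)) \<omega>2 =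
      e \<zeta> * (frakD r \<zeta> x y z \<omega>1 \<omega>2 * inverse \<eta>
      - frakD r \<eta> x y z \<omega>1 \<omega>2 * frakF (\<zeta> - \<eta>) (frac (y + real r * z)) \<omega>2)" for \<eta>
      unfolding D F right_diff_distrib e[of \<eta>, symmetric] by (simp only: mult_ac)
    moreover have "(\<lambda>\<eta>. frakD r \<zeta> x y z \<omega>1 \<omega>2 * inverse \<eta>
      - frakD r \<eta> x y z \<omega>1 \<omega>2 * frakF (\<zeta> - \<eta>) (frac (y + real r * z)) \<omega>2) meromorphic_on {0}"
      using frakF_meromorphic[of "-1" \<zeta> "frac (y + real r * z)" \<omega>2 "{0}"]
      by (intro meromorphic_intros frakD_meromorphic assms(1)) simp_all
    ultimately show ?thesis
      unfolding R_def by (simp add: residue_meromorphic_cmult)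
  qed
  hence "R t = (\<lambda>\<zeta>. e \<zeta> * R z \<zeta>)" by blast
  hence "remove_sings (R t) \<xi> = e \<xi> * remove_sings (R z) \<xi>"
    by (simp add: remove_sings_mult e_def)
  thus ?thesis
    by (simp add: frakK_res_def R_def[abs_def] e_def a_def)
qed

text \<open>The last hypothesis keeps both parameters in the branch of \<open>frakK\<close> given by
  the residue formula, unless they coincide and the factor is 1.\<close>

lemma frakK_exp:
  assumes "Im (\<omega>2 / \<omega>1) > 0" "\<lfloor>y + real r * t\<rfloor> = \<lfloor>y + real r * z\<rfloor>"
    and "t = z \<or> (x, y, t) \<noteq> (0, 0, 1) \<and> (x, y, z) \<noteq> (0, 0, 1)"
  shows "frakK r \<xi> x y t \<omega>1 \<omega>2 =
     exp (2 * of_real pi * \<i> * of_nat r / \<omega>2 * \<xi> * of_real (t - z)) * frakK r \<xi> x y z \<omega>1 \<omega>2"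
proof (cases "t = z")
  case False
  with assms(3) show ?thesis
    using frakK_res_exp[OF assms(1,2), where x = x] by (auto simp: frakK_def)
qed simp

section \<open>Taylor coefficients as functions of \<open>z\<close>\<close>

text \<open>Cauchy product of the exponential series in \<open>\<xi>\<close> with the Taylor series
  of \<open>frakK\<close> at the base point \<open>z\<close>.\<close>

lemma calK_eq_sum:
  assumes "\<omega>2 \<noteq> 0" "Im (\<omega>2 / \<omega>1) > 0" "\<lfloor>y + real r * t\<rfloor> = \<lfloor>y + real r * z\<rfloor>"
    and "t = z \<or> (x, y, t) \<noteq> (0, 0, 1) \<and> (x, y, z) \<noteq> (0, 0, 1)"
  defines "a \<equiv> 2 * of_real pi * \<i> * of_nat r / \<omega>2"
    and "c \<equiv> fps_nth (fps_expansion (\<lambda>\<xi>. frakK r \<xi> x y z \<omega>1 \<omega>2) 0)"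
  shows "calK k r x y t \<omega>1 \<omega>2 =
     fact k * (\<Sum>i = 0..k - 1. (a * of_real (t - z)) ^ i / fact i * c (k - 1 - i))"
proof -
  have "(\<lambda>\<xi>. exp ((a * of_real (t - z)) * \<xi>) * frakK r \<xi> x y z \<omega>1 \<omega>2) has_fps_expansion
      fps_exp (a * of_real (t - z)) * fps_expansion (\<lambda>\<xi>. frakK r \<xi> x y z \<omega>1 \<omega>2) 0"
    by (intro fps_expansion_intros analytic_at_imp_has_fps_expansion_0 frakK_analytic assms)
  also have "(\<lambda>\<xi>. exp ((a * of_real (t - z)) * \<xi>) * frakK r \<xi> x y z \<omega>1 \<omega>2) =
      (\<lambda>\<xi>. frakK r \<xi> x y t \<omega>1 \<omega>2)"
    using frakK_exp[OF assms(2-4)] by (simp add: a_def mult_ac)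
  finally show ?thesis
    by (simp add: calK_def fps_expansion_eqI fps_mult_nth c_def)
qed

text \<open>
  \<open>frakK\<close> is defined separately at \<open>(0, 0, 1)\<close>. This is harmless because, for \<open>y = 0\<close>, the point
  \<open>z = 1\<close> is alone on its piece of \<open>{0..1}\<close> with constant \<open>\<lfloor>y + r z\<rfloor>\<close>.
\<close>

lemma not_exceptional:
  fixes y t z :: real
  assumes "r \<ge> 1" "\<lfloor>y + real r * t\<rfloor> = \<lfloor>y + real r * z\<rfloor>" "t \<le> 1" "z \<le> 1"
  shows "t = z \<or> (x, y, t) \<noteq> (0, 0, 1) \<and> (x, y, z) \<noteq> (0, 0, 1)"
proof -
  have aux: "v = 1" if "v \<le> 1" "\<lfloor>real r * v\<rfloor> = \<lfloor>real r * 1\<rfloor>" for v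
  proof -
    \<comment> \<open>As \<open>r\<close> is an integer, the floor at 1 is \<open>r\<close>
      itself.\<close>
    have "real r \<le> real r * v" using that(2) of_int_floor_le[of "real r * v"] by simp
    thus ?thesis using that(1) assms(1) by simp
  qed
  show ?thesis using aux[of t] aux[of z] assms by auto
qed

lemma has_vector_derivative_exp_of_real_diff:
  "((\<lambda>t. exp (b * of_real (t - z)) * K) has_vector_derivative b * K) (at z)" for b K :: complex
proof -
  have "((\<lambda>s. exp (b * (s - of_real z)) * K) has_field_derivative b * K) (at (of_real z))"
    by (auto intro!: derivative_eq_intros)
  from has_vector_derivative_real_field[OF this] show ?thesis by simp
qed

text \<open>At \<open>t = z\<close> only the linear term contributes: the term \<open>i = 0\<close>
  is constant, and for \<open>i > 1\<close> a factor \<open>z - z\<close> remains after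
  differentiation.\<close>

lemma has_vector_derivative_exp_sum:
  fixes a :: complex and z :: real
  shows "((\<lambda>t. \<Sum>i = 0..Suc n. (a * of_real (t - z)) ^ i / fact i * c (Suc n - i))
            has_vector_derivative a * c n) (at z)"
proof -
  have "((\<lambda>s. (a * (s - of_real z)) ^ i / fact i * c (Suc n - i)) has_field_derivative
          (if i = 1 then a * c n else 0)) (at (of_real z))" for i
  proof (cases i)
    case (Suc j)
    thus ?thesis
    proof (cases j)
      case 0
      with Suc show ?thesis by (auto intro!: derivative_eq_intros)
    next
      case (Suc l)
      with \<open>i = Suc j\<close> show ?thesis
        by (auto intro!: derivative_eq_intros simp del: fact_Suc of_nat_Suc)
    qed
  qed auto
  hence "((\<lambda>s. \<Sum>i = 0..Suc n. (a * (s - of_real z)) ^ i / fact i * c (Suc n - i)) has_field_derivative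
      (\<Sum>i = 0..Suc n. if i = 1 then a * c n else 0)) (at (of_real z))"
    by (rule DERIV_sum)
  moreover have "(\<Sum>i = 0..Suc n. if i = 1 then a * c n else 0) = a * c n"
    by (subst sum.delta) auto
  ultimately show ?thesis
    using has_vector_derivative_real_field by (simp only: of_real_diff)
qed

text \<open>The \<open>i\<close>-th term has degree at most \<open>i\<close>, so only
  \<open>i = n\<close> can contribute to the coefficient of degree \<open>n\<close>.\<close>

lemma poly_exp_sum:
  fixes a u :: complex and c :: "nat \<Rightarrow> complex"
  obtains p where "\<And>t. poly p t = (\<Sum>i = 0..n. (a * (t - u)) ^ i / fact i * c (n - i))"
    "degree p \<le> n" "coeff p n = a ^ n / fact n * c 0"
proof -
  define q where "q i = smult (a ^ i / fact i * c (n - i)) ([:-u, 1:] ^ i)" for i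
  have deg: "degree (q i) \<le> i" for i
    unfolding q_def by (rule order_trans[OF degree_smult_le]) (simp add: degree_linear_power)
  have "poly (\<Sum>i = 0..n. q i) t = (\<Sum>i = 0..n. (a * (t - u)) ^ i / fact i * c (n - i))" for t
    by (simp add: q_def poly_sum poly_power power_mult_distrib mult_ac)
  moreover have "degree (\<Sum>i = 0..n. q i) \<le> n"
    by (rule degree_sum_le) (auto intro: order_trans[OF deg])
  moreover have "coeff (\<Sum>i = 0..n. q i) n = a ^ n / fact n * c 0"
  proof -
    have "coeff (q i) n = (if i = n then a ^ n / fact n * c 0 else 0)" if "i \<in> {0..n}" for i
    proof (cases "i = n")
      case True
      thus ?thesis by (simp add: q_def coeff_linear_power)
    next
      case False
      with that deg[of i] show ?thesis by (simp add: coeff_eq_0)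
    qed
    hence "coeff (\<Sum>i = 0..n. q i) n = (\<Sum>i = 0..n. if i = n then a ^ n / fact n * c 0 else 0)"
      unfolding coeff_sum by (intro sum.cong) auto
    thus ?thesis by simp
  qed
  ultimately show thesis by (rule that)
qed

section \<open>The differential equations and the degree in \<open>z\<close>\<close>

theorem theorem5p2:
  fixes \<omega>1 \<omega>2 :: complex and r :: nat and x y :: real
  assumes "\<omega>1 \<noteq> 0" and "\<omega>2 \<noteq> 0" and "Im (\<omega>2 / \<omega>1) > 0"
    and "r \<ge> 1"
    and "-1 < x" and "x < 1" and "-1 < y" and "y < 1"
  shows "(\<forall>z::real. 0 \<le> z \<and> z \<le> 1 \<and> z \<notin> {(of_int n - y) / real r | n::int. True} \<longrightarrow>
            (\<forall>\<xi>::complex. \<xi> \<noteq> 0 \<longrightarrow>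
               (\<lambda>t. frakK r \<xi> x y t \<omega>1 \<omega>2) differentiable (at z) \<and>
               \<omega>2 / (2 * of_real pi * \<i> * of_nat r * \<xi>) *
                 vector_derivative (\<lambda>t. frakK r \<xi> x y t \<omega>1 \<omega>2) (at z)
               = frakK r \<xi> x y z \<omega>1 \<omega>2) \<and>
            (\<forall>k::nat. k \<ge> 2 \<longrightarrow>
               (\<lambda>t. calK k r x y t \<omega>1 \<omega>2) differentiable (at z) \<and>
               \<omega>2 / (2 * of_real pi * \<i> * of_nat r) *
                 vector_derivative (\<lambda>t. calK k r x y t \<omega>1 \<omega>2) (at z)
               = of_nat k * calK (k - 1) r x y z \<omega>1 \<omega>2))
       \<and> (\<forall>(k::nat) (I::real set) (m::int).
            k \<ge> 1 \<and> is_interval I \<and> I \<subseteq> {0..1} \<and> (\<forall>z\<in>I. \<lfloor>y + real r * z\<rfloor> = m) \<longrightarrow>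
            (\<exists>p::complex poly.
               (\<forall>z\<in>I. calK k r x y z \<omega>1 \<omega>2 = poly p (of_real z)) \<and>
               degree p \<le> k - 1 \<and>
               (\<forall>z\<in>I. (p \<noteq> 0 \<and> degree p = k - 1) \<longleftrightarrow> frakK r 0 x y z \<omega>1 \<omega>2 \<noteq> 0)))"
proof -
  define a where "a = 2 * of_real pi * \<i> * of_nat r / \<omega>2"
  have a: "a \<noteq> 0" using assms by (simp add: a_def)
  define good where "good t z \<longleftrightarrow> \<lfloor>y + real r * t\<rfloor> = \<lfloor>y + real r * z\<rfloor> \<and>
      (t = z \<or> (x, y, t) \<noteq> (0, 0, 1) \<and> (x, y, z) \<noteq> (0, 0, 1))" for t z
  define c where "c z = fps_nth (fps_expansion (\<lambda>\<xi>. frakK r \<xi> x y z \<omega>1 \<omega>2) 0)" for z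
  have K: "frakK r \<xi> x y t \<omega>1 \<omega>2 = exp (a * \<xi> * of_real (t - z)) * frakK r \<xi> x y z \<omega>1 \<omega>2"
    if "good t z" for t z \<xi>
    unfolding a_def by (rule frakK_exp) (use assms that in \<open>auto simp: good_def\<close>)
  have calK: "calK k r x y t \<omega>1 \<omega>2 =
      fact k * (\<Sum>i = 0..k - 1. (a * of_real (t - z)) ^ i / fact i * c z (k - 1 - i))"
    if "good t z" for t z k
    unfolding a_def c_def by (rule calK_eq_sum) (use assms that in \<open>auto simp: good_def\<close>)
  \<comment> \<open>Away from the excluded points \<open>y + r z\<close> is not an integer, so its
    floor is locally constant and \<open>good t z\<close> holds for all \<open>t\<close> near
    \<open>z\<close>. Derivatives at \<open>z\<close> may thus be computed from the explicit
    formulas based at \<open>z\<close>.\<close>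
  have local_deriv: "(f has_vector_derivative D) (at z)"
    if z: "z \<notin> {(of_int n - y) / real r | n::int. True}"
      and g: "(g has_vector_derivative D) (at z)" and eq: "\<And>t. good t z \<Longrightarrow> f t = g t"
    for f g :: "real \<Rightarrow> complex" and D z
  proof -
    have nint: "y + real r * z \<notin> \<int>"
    proof
      assume "y + real r * z \<in> \<int>"
      then obtain n :: int where "y + real r * z = of_int n" by (elim Ints_cases)
      hence "z = (of_int n - y) / real r" using assms(4) by (simp add: field_simps)
      with z show False by blast
    qed
    have "eventually (\<lambda>t. \<lfloor>y + real r * t\<rfloor> = \<lfloor>y + real r * z\<rfloor>) (nhds z)"
      by (rule eventually_floor_eq[OF _ nint]) (intro tendsto_intros filterlim_ident)
    \<comment> \<open>At the exceptional triple \<open>y + r z\<close> would be the integer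
      \<open>r\<close>.\<close>
    moreover have ne: "(x, y, z) \<noteq> (0, 0, 1)" using nint by auto
    hence "eventually (\<lambda>t. (x, y, t) \<noteq> (0, 0, 1)) (nhds z)"
      by (cases "(x, y) = (0, 0)") (auto intro: t1_space_nhds)
    ultimately have "eventually (\<lambda>t. good t z) (nhds z)"
      by eventually_elim (use ne in \<open>simp add: good_def\<close>)
    then obtain S where S: "open S" "z \<in> S" "\<And>t. t \<in> S \<Longrightarrow> good t z"
      by (auto simp: eventually_nhds)
    show ?thesis
      by (rule has_vector_derivative_transform_within_open[OF g S(1,2)]) (simp add: eq S(3))
  qed
  have frakK_deriv: "((\<lambda>t. frakK r \<xi> x y t \<omega>1 \<omega>2) has_vector_derivative
      a * \<xi> * frakK r \<xi> x y z \<omega>1 \<omega>2) (at z)"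
    if "z \<notin> {(of_int n - y) / real r | n::int. True}" for z \<xi>
    by (rule local_deriv[OF that has_vector_derivative_exp_of_real_diff]) (rule K)
  have calK_deriv: "((\<lambda>t. calK k r x y t \<omega>1 \<omega>2) has_vector_derivative
      a * of_nat k * calK (k - 1) r x y z \<omega>1 \<omega>2) (at z)"
    if z: "z \<notin> {(of_int n - y) / real r | n::int. True}" and k: "k \<ge> 2" for z k
  proof -
    from k obtain n where n: "k = Suc (Suc n)"
      by (metis Suc_le_D numeral_2_eq_2 Suc_le_mono)
    have "((\<lambda>t. fact k * (\<Sum>i = 0..Suc n. (a * of_real (t - z)) ^ i / fact i * c z (Suc n - i)))
        has_vector_derivative fact k * (a * c z n)) (at z)"
      by (intro has_vector_derivative_mult_right has_vector_derivative_exp_sum)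
    hence "((\<lambda>t. calK k r x y t \<omega>1 \<omega>2) has_vector_derivative fact k * (a * c z n)) (at z)"
      by (rule local_deriv[OF z]) (simp only: calK n diff_Suc_1)
    \<comment> \<open>\<open>calK (k - 1)\<close> carries the coefficient of index
      \<open>k - 2 = n\<close>, and \<open>fact k\<close> supplies the factor \<open>k\<close>
      besides \<open>fact (k - 1)\<close>.\<close>
    also have "fact k * (a * c z n) = a * of_nat k * calK (k - 1) r x y z \<omega>1 \<omega>2"
      by (simp add: n calK_def c_def)
    finally show ?thesis .
  qed
  have poly_on_interval: "\<exists>p::complex poly.
       (\<forall>z\<in>I. calK k r x y z \<omega>1 \<omega>2 = poly p (of_real z)) \<and> degree p \<le> k - 1 \<and>
       (\<forall>z\<in>I. (p \<noteq> 0 \<and> degree p = k - 1) \<longleftrightarrow> frakK r 0 x y z \<omega>1 \<omega>2 \<noteq> 0)"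
    if k: "k \<ge> 1" and I: "I \<subseteq> {0..1}" "\<forall>z\<in>I. \<lfloor>y + real r * z\<rfloor> = m" for k I m
  proof (cases "I = {}")
    case True
    thus ?thesis by (intro exI[of _ 0]) simp
  next
    case False
    \<comment> \<open>Any point of \<open>I\<close> serves as base point; one polynomial expanded
      about it is valid on all of \<open>I\<close>.\<close>
    then obtain z0 where z0: "z0 \<in> I" by blast
    have good: "good t z0" if "t \<in> I" for t
      unfolding good_def using that z0 I assms(4) by (intro conjI not_exceptional) auto
    obtain p where p: "\<And>t. poly p t = (\<Sum>i = 0..k - 1. (a * (t - of_real z0)) ^ i / fact i * c z0 (k - 1 - i))"
        "degree p \<le> k - 1" "coeff p (k - 1) = a ^ (k - 1) / fact (k - 1) * c z0 0"
      using poly_exp_sum[where n = "k - 1" and a = a and u = "of_real z0" and c = "c z0"] by blast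
    have "calK k r x y t \<omega>1 \<omega>2 = poly (smult (fact k) p) (of_real t)" if "t \<in> I" for t
      using calK[OF good[OF that], of k] by (simp add: p(1))
    moreover have "(smult (fact k) p \<noteq> 0 \<and> degree (smult (fact k) p) = k - 1) \<longleftrightarrow>
        frakK r 0 x y t \<omega>1 \<omega>2 \<noteq> 0" if "t \<in> I" for t
    proof -
      \<comment> \<open>At \<open>\<xi> = 0\<close> the exponential factor is 1, so this value is
        the same for all points of \<open>I\<close>.\<close>
      have "frakK r 0 x y t \<omega>1 \<omega>2 = c z0 0"
        using K[OF good[OF that], of 0] by (simp add: c_def fps_expansion_def)
      \<comment> \<open>The condition \<open>p \<noteq> 0\<close> matters for \<open>k = 1\<close>,
        since the zero polynomial also has degree 0.\<close>
      moreover have "(p \<noteq> 0 \<and> degree p = k - 1) \<longleftrightarrow> coeff p (k - 1) \<noteq> 0"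
        using p(2) le_degree[of p "k - 1"] leading_coeff_0_iff[of p] by (metis antisym coeff_0)
      ultimately show ?thesis unfolding p(3) using a by simp
    qed
    ultimately show ?thesis
      using p(2) by (intro exI[of _ "smult (fact k) p"]) auto
  qed
  have frakK_ode: "(\<lambda>t. frakK r \<xi> x y t \<omega>1 \<omega>2) differentiable (at z) \<and>
      \<omega>2 / (2 * of_real pi * \<i> * of_nat r * \<xi>) *
        vector_derivative (\<lambda>t. frakK r \<xi> x y t \<omega>1 \<omega>2) (at z) = frakK r \<xi> x y z \<omega>1 \<omega>2"
    if "z \<notin> {(of_int n - y) / real r | n::int. True}" "\<xi> \<noteq> 0" for z \<xi>
    using frakK_deriv[OF that(1), of \<xi>] assms(2,4) that(2)
    by (simp add: differentiableI_vector vector_derivative_at) (simp add: a_def)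
  have calK_ode: "(\<lambda>t. calK k r x y t \<omega>1 \<omega>2) differentiable (at z) \<and>
      \<omega>2 / (2 * of_real pi * \<i> * of_nat r) *
        vector_derivative (\<lambda>t. calK k r x y t \<omega>1 \<omega>2) (at z) = of_nat k * calK (k - 1) r x y z \<omega>1 \<omega>2"
    if "z \<notin> {(of_int n - y) / real r | n::int. True}" "k \<ge> 2" for z k
    using calK_deriv[OF that] assms(2,4)
    by (simp add: differentiableI_vector vector_derivative_at) (simp add: a_def)
  show ?thesis
    using frakK_ode calK_ode poly_on_interval by blast
qed

end
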